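(* Let $k\ge 1$ and let $w,g_1,\dots,g_k$ be indeterminates; work in $\mathbb{Q}(w,g_1,\dots,g_k)$. Let $\mathbf{M}_k$ be the $k\times k$ matrix with entries $(\mathbf{M}_k)_{i,i}=1$, $(\mathbf{M}_k)_{i,i+1}=-g_iw$ for $1\le i\le k-1$, and $(\mathbf{M}_k)_{i,j}=-g_i$ for all other $j\ne i$; let $\mathbf{e}_k=[1,\dots,1]$ (row vector of length $k$), $\mathbf{y}_k=[g_1,\dots,g_k]^T$, $\mathbf{z}_k=[g_1,\dots,g_{k-1},wg_k]^T$, and $\mathcal{G}_k=\mathbf{e}_k\mathbf{M}_k^{-1}\mathbf{y}_k$, $\mathcal{H}_k=\mathbf{e}_k\mathbf{M}_k^{-1}\mathbf{z}_k$. With $f_i=\frac{g_i}{1+g_i}$, $$\mathcal{G}_k=\frac{1}{1-\sum_{i=1}^k\sum_{l=0}^{i-1}(w-1)^l\prod_{j=i-l}^i f_j}-1,\qquad \mathcal{H}_k=\frac{\sum_{l=0}^k (w-1)^l\prod_{j=k-l+1}^k f_j}{1-\sum_{i=1}^k\sum_{l=0}^{i-1}(w-1)^l\prod_{j=i-l}^i f_j}-1,$$ where an empty product equals $1$. *)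

theory Defs
  imports
    "HOL-Library.Poly_Mapping"
    "HOL-Computational_Algebra.Fraction_Field"
    "Jordan_Normal_Form.Gauss_Jordan_Elimination"
begin

text \<open>
  Rational functions over the rationals in indeterminates numbered by the natural numbers:
  the fraction field of the polynomial ring, where a monomial is a finitely supported
  exponent function and a polynomial is a finitely supported coefficient function on monomials.
  Number 0 is the indeterminate \<open>w\<close>, number \<open>i \<ge> 1\<close> is \<open>g\<^sub>i\<close>. The field \<open>Q(w, g\<^sub>1, \<dots>, g\<^sub>k)\<close>
  is the subfield generated by the indeterminates \<open>0, \<dots>, k\<close>; using one field for all \<open>k\<close>
  affects neither equations between elements of that subfield nor inverses of matrices over it.
\<close>

type_synonym ratfun = "((nat \<Rightarrow>\<^sub>0 nat) \<Rightarrow>\<^sub>0 rat) fract"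

definition indet :: "nat \<Rightarrow> ratfun" where
  "indet i = Fraction_Field.Fract (Poly_Mapping.single (Poly_Mapping.single i 1) 1) 1"

definition var_w :: ratfun where
  "var_w = indet 0"

definition var_g :: "nat \<Rightarrow> ratfun" where
  "var_g i = indet i"

definition ratio_f :: "nat \<Rightarrow> ratfun" where
  "ratio_f i = var_g i / (1 + var_g i)"

text \<open>Only \<open>var_g i\<close> with \<open>i \<ge> 1\<close> is used below. Matrix indices start at 0, so row \<open>i\<close> below is row \<open>Suc i\<close> in 1-based numbering.\<close>

definition mat_M :: "nat \<Rightarrow> ratfun mat" where
  "mat_M k = mat k k (\<lambda>(i, j).
     if j = i then 1
     else if j = Suc i then - (var_g (Suc i) * var_w)
     else - var_g (Suc i))"

definition row_e :: "nat \<Rightarrow> ratfun mat" where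
  "row_e k = mat 1 k (\<lambda>_. 1)"

definition col_y :: "nat \<Rightarrow> ratfun mat" where
  "col_y k = mat k 1 (\<lambda>(i, _). var_g (Suc i))"

definition col_z :: "nat \<Rightarrow> ratfun mat" where
  "col_z k = mat k 1 (\<lambda>(i, _). if Suc i = k then var_w * var_g k else var_g (Suc i))"

text \<open>
  \<open>mat_inverse A\<close> is \<open>Some\<close> of the two-sided inverse if the square matrix \<open>A\<close> is invertible and
  \<open>None\<close> otherwise. The products are 1-by-1 matrices, identified with their single entry.
\<close>

definition \<G> :: "nat \<Rightarrow> ratfun" where
  "\<G> k = (row_e k * the (mat_inverse (mat_M k)) * col_y k) $$ (0, 0)"

definition \<H> :: "nat \<Rightarrow> ratfun" where
  "\<H> k = (row_e k * the (mat_inverse (mat_M k)) * col_z k) $$ (0, 0)"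

end

theory Submission
  imports Defs "Jordan_Normal_Form.Determinant"
begin

text \<open>
  Write \<open>c = w - 1\<close>. Row \<open>i\<close> of a system with matrix \<open>M\<^sub>k\<close> solves to
  \<open>x\<^sub>i = f\<^sub>i (s + c x\<^bsub>i+1\<^esub>)\<close>, where \<open>s\<close> is the sum of all unknowns plus a constant and
  \<open>x\<^bsub>k+1\<^esub>\<close> is \<open>0\<close> for the right-hand side \<open>y\<^sub>k\<close> and \<open>1\<close> for \<open>z\<^sub>k\<close>. Put
  \<open>\<beta>\<^sub>m = \<Sum>l<m. c\<^sup>l f\<^bsub>m-l\<^esub> \<cdots> f\<^sub>m\<close>, so that \<open>\<beta>\<^sub>m = f\<^sub>m (1 + c \<beta>\<^bsub>m-1\<^esub>)\<close>. Eliminating the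
  unknowns in increasing order gives \<open>x\<^sub>1 + \<dots> + x\<^sub>k = s (\<beta>\<^sub>1 + \<dots> + \<beta>\<^sub>k) + c \<beta>\<^sub>k x\<^bsub>k+1\<^esub>\<close>,
  a linear equation for the sum of the unknowns. Its leading coefficient
  \<open>1 - (\<beta>\<^sub>1 + \<dots> + \<beta>\<^sub>k)\<close> has value \<open>1\<close> at the origin, hence is nonzero, and this also yields
  the invertibility of \<open>M\<^sub>k\<close>.
\<close>

section \<open>Values of rational functions at the origin\<close>

abbreviation const_coeff :: "((nat \<Rightarrow>\<^sub>0 nat) \<Rightarrow>\<^sub>0 rat) \<Rightarrow> rat" where
  "const_coeff p \<equiv> Poly_Mapping.lookup p 0"

text \<open>Exponents are natural numbers, so two monomials multiply to 1 only if both are 1; a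
  single term of the convolution survives.\<close>

lemma const_coeff_mult:
  "const_coeff (p * q) = const_coeff p * const_coeff q"
proof -
  have split: "(a + b = 0) = (a = 0 \<and> b = 0)" for a b :: "nat \<Rightarrow>\<^sub>0 nat"
    by (auto simp: poly_mapping_eq_iff lookup_add fun_eq_iff plus_poly_mapping.rep_eq)
  have inner: "Sum_any (\<lambda>b. Poly_Mapping.lookup q b when a + b = 0) =
      (const_coeff q when a = 0)" for a
    by (cases "a = 0") (simp_all add: split)
  show ?thesis
    by (simp add: lookup_mult inner mult_when eq_commute[of 0])
qed

text \<open>A relation, because evaluation makes sense only for fractions with some denominator that
  does not vanish at the origin. A nonzero value certifies that the rational function is
  nonzero.\<close>

definition has_value_at_origin :: "ratfun \<Rightarrow> rat \<Rightarrow> bool" where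
  "has_value_at_origin x v \<longleftrightarrow>
     (\<exists>p q. x = Fraction_Field.Fract p q \<and> const_coeff q \<noteq> 0 \<and> v = const_coeff p / const_coeff q)"

lemma has_value_at_origin_Fract:
  assumes "const_coeff q \<noteq> 0"
  shows "has_value_at_origin (Fraction_Field.Fract p q) (const_coeff p / const_coeff q)"
  using assms by (auto simp: has_value_at_origin_def)

lemma has_value_at_origin_nonzero:
  assumes "has_value_at_origin x v" "v \<noteq> 0"
  shows "x \<noteq> 0"
proof -
  obtain p q where x: "x = Fraction_Field.Fract p q" and q: "const_coeff q \<noteq> 0"
    and v: "v = const_coeff p / const_coeff q"
    using assms by (auto simp: has_value_at_origin_def)
  have "p \<noteq> 0" "q \<noteq> 0" using q v assms(2) by auto
  then show ?thesis by (simp add: x Zero_fract_def eq_fract)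
qed

lemma has_value_at_origin_add:
  assumes "has_value_at_origin x a" "has_value_at_origin y b"
  shows "has_value_at_origin (x + y) (a + b)"
proof -
  obtain p q r s where *: "x = Fraction_Field.Fract p q" "const_coeff q \<noteq> 0"
    "a = const_coeff p / const_coeff q"
    "y = Fraction_Field.Fract r s" "const_coeff s \<noteq> 0" "b = const_coeff r / const_coeff s"
    using assms unfolding has_value_at_origin_def by blast
  then have "q \<noteq> 0" "s \<noteq> 0" by auto
  then have "x + y = Fraction_Field.Fract (p * s + r * q) (q * s)"
    using * by simp
  moreover have "a + b = const_coeff (p * s + r * q) / const_coeff (q * s)"
    using * by (simp add: lookup_add const_coeff_mult add_frac_eq)
  moreover have "const_coeff (q * s) \<noteq> 0"
    using * by (simp add: const_coeff_mult)
  ultimately show ?thesis using has_value_at_origin_def by blast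
qed

lemma has_value_at_origin_mult:
  assumes "has_value_at_origin x a" "has_value_at_origin y b"
  shows "has_value_at_origin (x * y) (a * b)"
proof -
  obtain p q r s where *: "x = Fraction_Field.Fract p q" "const_coeff q \<noteq> 0"
    "a = const_coeff p / const_coeff q"
    "y = Fraction_Field.Fract r s" "const_coeff s \<noteq> 0" "b = const_coeff r / const_coeff s"
    using assms unfolding has_value_at_origin_def by blast
  then show ?thesis
    using has_value_at_origin_Fract[of "q * s" "p * r"] by (simp add: const_coeff_mult)
qed

lemma has_value_at_origin_inverse:
  assumes "has_value_at_origin x a" "a \<noteq> 0"
  shows "has_value_at_origin (inverse x) (inverse a)"
proof -
  obtain p q where *: "x = Fraction_Field.Fract p q" "const_coeff q \<noteq> 0"
    "a = const_coeff p / const_coeff q"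
    using assms unfolding has_value_at_origin_def by blast
  with assms(2) show ?thesis
    using has_value_at_origin_Fract[of p q] by simp
qed

lemma has_value_at_origin_0: "has_value_at_origin 0 0"
  using has_value_at_origin_Fract[of 1 0] by (simp add: Zero_fract_def lookup_one)

lemma has_value_at_origin_1: "has_value_at_origin 1 1"
  using has_value_at_origin_Fract[of 1 1] by (simp add: One_fract_def lookup_one)

lemma has_value_at_origin_uminus:
  assumes "has_value_at_origin x a"
  shows "has_value_at_origin (- x) (- a)"
proof -
  obtain p q where *: "x = Fraction_Field.Fract p q" "const_coeff q \<noteq> 0"
    "a = const_coeff p / const_coeff q"
    using assms unfolding has_value_at_origin_def by blast
  then show ?thesis
    using has_value_at_origin_Fract[of q "- p"] by simp
qed

lemma has_value_at_origin_indet: "has_value_at_origin (indet i) 0"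
proof -
  have "Poly_Mapping.single i (1::nat) \<noteq> 0"
    by (simp add: poly_mapping_eq_iff fun_eq_iff lookup_single when_def)
  then have "const_coeff (Poly_Mapping.single (Poly_Mapping.single i (1::nat)) (1::rat)) = 0"
    by (simp add: lookup_single when_def)
  then show ?thesis
    using has_value_at_origin_Fract[of 1 "Poly_Mapping.single (Poly_Mapping.single i 1) 1"]
    by (simp add: indet_def lookup_one)
qed

lemma one_plus_var_g_nonzero: "1 + var_g i \<noteq> 0"
  using has_value_at_origin_nonzero
    [OF has_value_at_origin_add[OF has_value_at_origin_1 has_value_at_origin_indet]]
  by (simp add: var_g_def)

lemma has_value_at_origin_ratio_f: "has_value_at_origin (ratio_f i) 0"
proof -
  have "has_value_at_origin (1 + var_g i) 1"
    using has_value_at_origin_add[OF has_value_at_origin_1 has_value_at_origin_indet]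
    by (simp add: var_g_def)
  from has_value_at_origin_mult[OF has_value_at_origin_indet has_value_at_origin_inverse[OF this]]
  show ?thesis by (simp add: ratio_f_def var_g_def divide_inverse)
qed

section \<open>The sums \<open>\<beta>\<^sub>m\<close> and the linear recurrence\<close>

definition chain_sum :: "'a::comm_ring_1 \<Rightarrow> (nat \<Rightarrow> 'a) \<Rightarrow> nat \<Rightarrow> 'a" where
  "chain_sum c f m = (\<Sum>l<m. c ^ l * (\<Prod>j=m-l..m. f j))"

lemma chain_sum_0 [simp]: "chain_sum c f 0 = 0"
  by (simp add: chain_sum_def)

text \<open>The term l = 0 is the empty product 1; shifting l in the rest pulls out one factor c.
  This gives both the recurrence for \<open>chain_sum\<close> and the numerator of
  \<open>\<H> k\<close>.\<close>

lemma one_plus_chain_sum: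
  "1 + c * chain_sum c f m = (\<Sum>l=0..m. c ^ l * (\<Prod>j=m-l+1..m. f j))"
proof -
  have "(\<Sum>l=0..m. c ^ l * (\<Prod>j=m-l+1..m. f j))
      = (\<Sum>l<Suc m. c ^ l * (\<Prod>j=m-l+1..m. f j))"
    by (rule sum.cong) auto
  also have "\<dots> = 1 + (\<Sum>l<m. c ^ Suc l * (\<Prod>j=m-Suc l+1..m. f j))"
    by (subst sum.lessThan_Suc_shift) simp
  also have "(\<Sum>l<m. c ^ Suc l * (\<Prod>j=m-Suc l+1..m. f j))
      = (\<Sum>l<m. c * (c ^ l * (\<Prod>j=m-l..m. f j)))"
    by (rule sum.cong) (auto simp: Suc_diff_Suc mult.assoc)
  finally show ?thesis
    by (simp add: chain_sum_def sum_distrib_left)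
qed

lemma chain_sum_Suc: "chain_sum c f (Suc m) = f (Suc m) * (1 + c * chain_sum c f m)"
proof -
  have "chain_sum c f (Suc m) = (\<Sum>l=0..m. c ^ l * (\<Prod>j=Suc m-l..Suc m. f j))"
    unfolding chain_sum_def by (rule sum.cong) auto
  also have "\<dots> = (\<Sum>l=0..m. f (Suc m) * (c ^ l * (\<Prod>j=m-l+1..m. f j)))"
    by (rule sum.cong) (auto simp: Suc_diff_le prod.nat_ivl_Suc')
  finally show ?thesis
    by (simp only: one_plus_chain_sum sum_distrib_left)
qed

lemma sum_chain_sum:
  "(\<Sum>i=1..k. \<Sum>l=0..i-1. c ^ l * (\<Prod>j=i-l..i. f j)) = (\<Sum>i=1..k. chain_sum c f i)"
  unfolding chain_sum_def by (intro sum.cong refl) auto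

text \<open>Induction on k: adding \<open>x (Suc k)\<close> to the sum up to k gives it the
  coefficient \<open>1 + c * chain_sum c f k\<close>; expanding it by its own equation turns this
  coefficient into \<open>chain_sum c f (Suc k)\<close>.\<close>

lemma sum_linear_recurrence:
  fixes x :: "nat \<Rightarrow> 'a::comm_ring_1"
  assumes "\<And>i. 1 \<le> i \<Longrightarrow> i \<le> k \<Longrightarrow> x i = f i * (s + c * x (Suc i))"
  shows "(\<Sum>i=1..k. x i) = s * (\<Sum>i=1..k. chain_sum c f i) + c * chain_sum c f k * x (Suc k)"
  using assms
proof (induction k)
  case 0
  then show ?case by simp
next
  case (Suc k)
  have "(\<Sum>i=1..Suc k. x i)
      = s * (\<Sum>i=1..k. chain_sum c f i) + (1 + c * chain_sum c f k) * x (Suc k)"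
    using Suc by (simp add: algebra_simps)
  also have "x (Suc k) = f (Suc k) * (s + c * x (Suc (Suc k)))"
    using Suc.prems by simp
  finally show ?case
    by (simp add: chain_sum_Suc algebra_simps)
qed

text \<open>By the recurrence each sum is \<open>ratio_f\<close>, which vanishes at the origin,
  times a factor that is regular there by induction.\<close>

lemma has_value_at_origin_chain_sum: "has_value_at_origin (chain_sum (var_w - 1) ratio_f m) 0"
proof (induction m)
  case 0
  show ?case by (simp add: has_value_at_origin_0)
next
  case (Suc m)
  have "has_value_at_origin (var_w - 1) (- 1)"
    using has_value_at_origin_add
      [OF has_value_at_origin_indet has_value_at_origin_uminus[OF has_value_at_origin_1]]
    by (simp add: var_w_def)
  from has_value_at_origin_mult[OF has_value_at_origin_ratio_f
      has_value_at_origin_add[OF has_value_at_origin_1 has_value_at_origin_mult[OF this Suc]]]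
  show ?case by (simp add: chain_sum_Suc)
qed

lemma one_minus_sum_chain_sum_nonzero:
  "1 - (\<Sum>i=1..k. chain_sum (var_w - 1) ratio_f i) \<noteq> 0"
proof -
  have "has_value_at_origin (\<Sum>i=1..k. chain_sum (var_w - 1) ratio_f i) 0"
  proof (induction k)
    case 0
    show ?case by (simp add: has_value_at_origin_0)
  next
    case (Suc k)
    from has_value_at_origin_add[OF this has_value_at_origin_chain_sum] show ?case by simp
  qed
  from has_value_at_origin_add[OF has_value_at_origin_1 has_value_at_origin_uminus[OF this]]
  have "has_value_at_origin (1 - (\<Sum>i=1..k. chain_sum (var_w - 1) ratio_f i)) 1" by simp
  then show ?thesis by (rule has_value_at_origin_nonzero) simp
qed

section \<open>Linear systems with matrix \<open>mat_M k\<close>\<close>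

lemma mat_M_carrier: "mat_M k \<in> carrier_mat k k"
  by (simp add: mat_M_def)

text \<open>Each row is a constant row of entries -g, corrected by 1 + g on the diagonal and by -g
  (w - 1) on the superdiagonal; the last row has no superdiagonal entry, hence the default
  0.\<close>

lemma mat_M_mult_vec_index:
  assumes "x \<in> carrier_vec k" "i < k"
  shows "(mat_M k *\<^sub>v x) $ i = (1 + var_g (Suc i)) * x $ i
    - var_g (Suc i) * ((\<Sum>j<k. x $ j) + (var_w - 1) * (if Suc i < k then x $ Suc i else 0))"
proof -
  let ?g = "var_g (Suc i)"
  have "(mat_M k *\<^sub>v x) $ i = (\<Sum>j<k. mat_M k $$ (i, j) * x $ j)"
    using assms by (auto simp: mat_M_def scalar_prod_def lessThan_atLeast0 intro!: sum.cong)
  also have "\<dots> = (\<Sum>j<k. (if j = i then (1 + ?g) * x $ i else 0) - ?g * x $ j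
      - (if j = Suc i then ?g * (var_w - 1) * x $ Suc i else 0))"
    using assms by (intro sum.cong) (auto simp: mat_M_def algebra_simps)
  also have "\<dots> = (1 + ?g) * x $ i - ?g * (\<Sum>j<k. x $ j)
      - (if Suc i < k then ?g * (var_w - 1) * x $ Suc i else 0)"
    using assms by (simp add: sum_subtractf sum_distrib_left)
  finally show ?thesis by (cases "Suc i < k") (simp_all add: algebra_simps)
qed

text \<open>
  The parameter \<open>b\<close> plays the role of the unknown \<open>x\<^bsub>k+1\<^esub>\<close>: the right-hand sides \<open>0\<close>,
  \<open>y\<^sub>k\<close>, \<open>z\<^sub>k\<close> are the cases \<open>(a, b) = (0, 0), (1, 0), (1, 1)\<close>.
\<close>

lemma mat_M_system:
  assumes x: "x \<in> carrier_vec k"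
    and eq: "mat_M k *\<^sub>v x =
      vec k (\<lambda>i. var_g (Suc i) * (a + (if Suc i = k then (var_w - 1) * b else 0)))"
  defines "s \<equiv> a + (\<Sum>j<k. x $ j)"
  shows "i < k \<Longrightarrow> x $ i = ratio_f (Suc i) * (s + (var_w - 1) * (if Suc i < k then x $ Suc i else b))"
    and "(\<Sum>j<k. x $ j) = s * (\<Sum>i=1..k. chain_sum (var_w - 1) ratio_f i)
          + (var_w - 1) * chain_sum (var_w - 1) ratio_f k * b"
proof -
  show row: "x $ i = ratio_f (Suc i) * (s + (var_w - 1) * (if Suc i < k then x $ Suc i else b))"
    if i: "i < k" for i
  proof -
    \<comment> \<open>In the last row the term with \<open>b\<close> comes from the right-hand side;
      in the others the successor term comes from the superdiagonal.\<close>
    have "(1 + var_g (Suc i)) * x $ i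
        = var_g (Suc i) * (s + (var_w - 1) * (if Suc i < k then x $ Suc i else b))"
      using mat_M_mult_vec_index[OF x i] i
      by (cases "Suc i = k") (simp_all add: eq s_def algebra_simps)
    then show ?thesis
      using one_plus_var_g_nonzero[of "Suc i"] by (simp add: ratio_f_def field_simps)
  qed
  \<comment> \<open>The unknowns renumbered from 1, with \<open>b\<close> appended as number
    \<open>Suc k\<close>.\<close>
  define X where "X i = (if i \<le> k then x $ (i - 1) else b)" for i
  have "X i = ratio_f i * (s + (var_w - 1) * X (Suc i))" if "1 \<le> i" "i \<le> k" for i
    using row[of "i - 1"] that by (auto simp: X_def)
  from sum_linear_recurrence[of k X, OF this]
  have "(\<Sum>i=1..k. X i) = s * (\<Sum>i=1..k. chain_sum (var_w - 1) ratio_f i)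
          + (var_w - 1) * chain_sum (var_w - 1) ratio_f k * X (Suc k)" .
  moreover have "(\<Sum>i=1..k. X i) = (\<Sum>j<k. x $ j)"
    by (rule sum.reindex_bij_witness[of _ Suc "\<lambda>i. i - 1"]) (auto simp: X_def)
  ultimately show "(\<Sum>j<k. x $ j) = s * (\<Sum>i=1..k. chain_sum (var_w - 1) ratio_f i)
          + (var_w - 1) * chain_sum (var_w - 1) ratio_f k * b"
    by (simp add: X_def)
qed

section \<open>Invertibility of \<open>mat_M k\<close>\<close>

lemma mat_M_kernel:
  assumes x: "x \<in> carrier_vec k" and "mat_M k *\<^sub>v x = 0\<^sub>v k"
  shows "x = 0\<^sub>v k"
proof -
  have eq: "mat_M k *\<^sub>v x =
      vec k (\<lambda>i. var_g (Suc i) * (0 + (if Suc i = k then (var_w - 1) * 0 else 0)))"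
    using assms by (auto intro!: eq_vecI)
  let ?S = "\<Sum>j<k. x $ j"
  \<comment> \<open>For a = b = 0 the constant s is the sum itself, so the sum formula becomes
    homogeneous.\<close>
  have "?S * (1 - (\<Sum>i=1..k. chain_sum (var_w - 1) ratio_f i)) = 0"
    using mat_M_system(2)[OF x eq] by (simp add: algebra_simps)
  then have S: "?S = 0"
    using one_minus_sum_chain_sum_nonzero[of k] by simp
  \<comment> \<open>Now each unknown is a multiple of its successor and the last one is 0; d counts
    the distance from the end.\<close>
  have from_end: "x $ (k - Suc d) = 0" if "d < k" for d
    using that
  proof (induction d)
    case 0
    then show ?case using mat_M_system(1)[OF x eq, of "k - 1"] by (simp add: S)
  next
    case (Suc d)
    then show ?case
      using mat_M_system(1)[OF x eq, of "k - Suc (Suc d)"] by (simp add: S Suc_diff_Suc)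
  qed
  have "x $ i = 0" if "i < k" for i
    using from_end[of "k - Suc i"] that by (simp add: Suc_diff_Suc)
  then show ?thesis
    using x by (auto intro!: eq_vecI)
qed

lemma det_mat_M_nonzero: "det (mat_M k) \<noteq> 0"
  using mat_M_kernel det_0_iff_vec_prod_zero_field[OF mat_M_carrier] by blast

text \<open>A nonzero determinant rules out \<open>None\<close>, so \<open>the\<close> in
  \<open>\<G>\<close> and \<open>\<H>\<close> selects the true inverse.\<close>

lemma mat_inverse_mat_M:
  obtains N where "mat_inverse (mat_M k) = Some N" "N \<in> carrier_mat k k"
    "mat_M k * N = 1\<^sub>m k" "N * mat_M k = 1\<^sub>m k"
proof (cases "mat_inverse (mat_M k)")
  case None
  have "mat_M k \<in> Units (ring_mat TYPE(ratfun) k ())"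
    by (rule det_non_zero_imp_unit[OF mat_M_carrier det_mat_M_nonzero])
  then show ?thesis
    using mat_inverse(1)[OF mat_M_carrier None, of "()"] by simp
next
  case (Some N)
  then show ?thesis
    using mat_inverse(2)[OF mat_M_carrier Some] that by blast
qed

lemma invertible_mat_M: "invertible_mat (mat_M k)"
proof -
  obtain N where "N \<in> carrier_mat k k" "mat_M k * N = 1\<^sub>m k" "N * mat_M k = 1\<^sub>m k"
    by (rule mat_inverse_mat_M)
  then show ?thesis
    using mat_M_carrier[of k] by (auto simp: invertible_mat_def inverts_mat_def square_mat.simps)
qed

section \<open>Closed forms of \<open>\<G>\<close> and \<open>\<H>\<close>\<close>

lemma row_mat_inverse_col:
  assumes "C = mat k 1 (\<lambda>(i, _). var_g (Suc i) * (1 + (if Suc i = k then (var_w - 1) * b else 0)))"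
  shows "(row_e k * the (mat_inverse (mat_M k)) * C) $$ (0, 0) =
    (1 + (var_w - 1) * chain_sum (var_w - 1) ratio_f k * b)
      / (1 - (\<Sum>i=1..k. chain_sum (var_w - 1) ratio_f i)) - 1"
proof -
  obtain N where N: "mat_inverse (mat_M k) = Some N" "N \<in> carrier_mat k k" "mat_M k * N = 1\<^sub>m k"
    by (rule mat_inverse_mat_M)
  have C: "C \<in> carrier_mat k 1" and e: "row_e k \<in> carrier_mat 1 k"
    using assms by (simp_all add: row_e_def)
  define x where "x = N *\<^sub>v col C 0"
  have x: "x \<in> carrier_vec k"
    unfolding x_def using N(2) by (rule mult_mat_vec_carrier) (use C in auto)
  have "mat_M k *\<^sub>v x = (mat_M k * N) *\<^sub>v col C 0"
    unfolding x_def using N C mat_M_carrier by (intro assoc_mult_mat_vec[symmetric]) auto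
  also have "\<dots> = col C 0"
    unfolding N(3) by (rule one_mult_mat_vec) (use C in auto)
  also have "\<dots> = vec k (\<lambda>i. var_g (Suc i) * (1 + (if Suc i = k then (var_w - 1) * b else 0)))"
    using assms by (auto intro!: eq_vecI)
  \<comment> \<open>The case a = 1, where s is 1 plus the sum of the unknowns.\<close>
  finally have sum: "(\<Sum>j<k. x $ j)
      = (1 + (\<Sum>j<k. x $ j)) * (\<Sum>i=1..k. chain_sum (var_w - 1) ratio_f i)
        + (var_w - 1) * chain_sum (var_w - 1) ratio_f k * b"
    by (rule mat_M_system(2)[OF x])
  have "row_e k * N * C = row_e k * (N * C)"
    using e N C by (intro assoc_mult_mat) auto
  moreover have "col (N * C) 0 = x"
    using N C by (auto simp: x_def intro!: eq_vecI)
  ultimately have "(row_e k * N * C) $$ (0, 0) = row (row_e k) 0 \<bullet> x"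
    using e N C by simp
  also have "\<dots> = (\<Sum>j<k. x $ j)"
    using x by (auto simp: scalar_prod_def row_e_def lessThan_atLeast0 intro!: sum.cong)
  finally have entry: "(row_e k * N * C) $$ (0, 0) = (\<Sum>j<k. x $ j)" .
  \<comment> \<open>Adding 1 to both sides makes 1 + t the natural unknown, which explains the final
    -1.\<close>
  have solve: "t = (1 + r) / (1 - u) - 1" if "t = (1 + t) * u + r" "1 - u \<noteq> 0" for t u r :: ratfun
  proof -
    have "(1 + t) * (1 - u) = 1 + r"
      using that(1) by (simp add: algebra_simps)
    then show ?thesis
      using that(2) by (metis add_diff_cancel_left' nonzero_eq_divide_eq)
  qed
  show ?thesis
    unfolding N(1) option.sel entry
    by (rule solve[OF sum one_minus_sum_chain_sum_nonzero])
qed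

theorem theorem2:
  fixes k :: nat
  assumes "k \<ge> 1"
  shows "invertible_mat (mat_M k)
    \<and> (\<forall>i\<in>{1..k}. 1 + var_g i \<noteq> 0)
    \<and> 1 - (\<Sum>i=1..k. \<Sum>l=0..i-1. (var_w - 1) ^ l * (\<Prod>j=i-l..i. ratio_f j)) \<noteq> 0
    \<and> \<G> k = 1 / (1 - (\<Sum>i=1..k. \<Sum>l=0..i-1. (var_w - 1) ^ l * (\<Prod>j=i-l..i. ratio_f j))) - 1
    \<and> \<H> k = (\<Sum>l=0..k. (var_w - 1) ^ l * (\<Prod>j=k-l+1..k. ratio_f j))
           / (1 - (\<Sum>i=1..k. \<Sum>l=0..i-1. (var_w - 1) ^ l * (\<Prod>j=i-l..i. ratio_f j))) - 1"
proof -
  have "col_y k = mat k 1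
      (\<lambda>(i, _). var_g (Suc i) * (1 + (if Suc i = k then (var_w - 1) * 0 else 0)))"
    by (auto simp: col_y_def intro!: eq_matI)
  then have "\<G> k = 1 / (1 - (\<Sum>i=1..k. chain_sum (var_w - 1) ratio_f i)) - 1"
    using row_mat_inverse_col[of "col_y k" k 0] by (simp add: \<G>_def)
  \<comment> \<open>The last entry fits because w = 1 + (w - 1).\<close>
  moreover have "col_z k = mat k 1
      (\<lambda>(i, _). var_g (Suc i) * (1 + (if Suc i = k then (var_w - 1) * 1 else 0)))"
    by (auto simp: col_z_def algebra_simps intro!: eq_matI)
  then have "\<H> k = (1 + (var_w - 1) * chain_sum (var_w - 1) ratio_f k)
      / (1 - (\<Sum>i=1..k. chain_sum (var_w - 1) ratio_f i)) - 1"
    using row_mat_inverse_col[of "col_z k" k 1] by (simp add: \<H>_def)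
  ultimately show ?thesis
    unfolding sum_chain_sum one_plus_chain_sum[symmetric]
    using invertible_mat_M one_plus_var_g_nonzero one_minus_sum_chain_sum_nonzero by blast
qed

end
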